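(* The lattice $\varphi_\beta(\mathcal{M})\subset\mathbb{R}^n$, with $\beta=p^{-2}\left(\frac1k-\frac{\theta}{2k}\right)$, is a rotated version of $D_n$, i.e. it equals $D_nQ$ for some real orthogonal $n\times n$ matrix $Q$.
   Context: Let $l>1$ be odd and $p$ a prime with $p\equiv1\pmod l$; let $\zeta_p=e^{2\pi i/p}$, $r$ a primitive root mod $p$, $\sigma\in\mathrm{Gal}(\mathbb{Q}(\zeta_p)/\mathbb{Q})$ with $\sigma(\zeta_p)=\zeta_p^r$, $\mathbb{K}=\{y\in\mathbb{Q}(\zeta_p):\sigma^l(y)=y\}$ (totally real, degree $l$). Let $\alpha=\prod_{j=0}^{(p-3)/2}(1-\zeta_p^{r^j})$, $\lambda$ an integer with $\lambda(r-1)\equiv1\pmod p$, $z=\zeta_p^\lambda\alpha(1-\zeta_p)$, $x=\sum_{j=1}^{(p-1)/l}\sigma^{jl}(z)\in\mathcal{O}_\mathbb{K}$. Let $m\ge3$, $k=2^{m-2}$, $\omega=e^{2\pi i/2^m}$, $\theta_j=\omega^j+\omega^{-j}$, $\theta=\theta_1$, $\mathbb{L}=\mathbb{Q}(\theta)$ (totally real, degree $k$), $w_0=1$, $w_i=1+\theta_1+\dots+\theta_i$ ($1\le i\le k-1$). Let $n=kl$ and $\mathbb{KL}\subset\mathbb{R}$ the compositum, totally real of degree $n$, whose $n$ real embeddings are obtained by combining the embeddings $\sigma^i|_\mathbb{K}$ ($0\le i<l$) and $\tau^j$ ($0\le j<k$), $\tau$ a generator of $\mathrm{Gal}(\mathbb{L}/\mathbb{Q})$.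 For totally positive $\beta\in\mathbb{KL}$, $\varphi_\beta(y)=(\sqrt{\rho(\beta)}\rho(y))_\rho\in\mathbb{R}^n$, $\rho$ running over the embeddings in a fixed order. Let $\mathcal{M}$ be the $\mathbb{Z}$-module generated by $w_0(x+\sigma(x))$; the elements $w_i\sigma^{l-1}(x)-w_{i+1}x$ for $0\le i\le k-2$; and the elements $w_j(\sigma^i(x)-\sigma^{i+1}(x))$ for $0\le j\le k-1$, $0\le i\le l-2$. $D_n=\{y\in\mathbb{Z}^n:\sum y_i\text{ even}\}$. *)

theory Defs
  imports "HOL-Number_Theory.Number_Theory" "HOL-Analysis.Analysis"
begin

definition zpow :: "nat \<Rightarrow> int \<Rightarrow> complex" where
  "zpow p e = cis (2 * pi * of_int e / of_nat p)"

text \<open>sigma^t(z), where sigma(zeta_p) = zeta_p^r and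
  z = zeta_p^lam * alpha * (1 - zeta_p), alpha = prod_{j=0}^{(p-3)/2} (1 - zeta_p^(r^j)).\<close>
definition sig_z :: "nat \<Rightarrow> nat \<Rightarrow> int \<Rightarrow> nat \<Rightarrow> complex" where
  "sig_z p r lam t =
     zpow p (lam * int r ^ t)
     * (\<Prod>j<(p - 1) div 2. (1 - zpow p (int r ^ (j + t))))
     * (1 - zpow p (int r ^ t))"

text \<open>sigma^t(x) with x = sum_{j=1}^{(p-1)/l} sigma^{jl}(z); x lies in the totally real
  field K, so this complex number is real and we take its real part.\<close>
definition sig_x :: "nat \<Rightarrow> nat \<Rightarrow> nat \<Rightarrow> int \<Rightarrow> nat \<Rightarrow> real" where
  "sig_x p l r lam t = Re (\<Sum>j\<in>{1..(p - 1) div l}. sig_z p r lam (j * l + t))"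

text \<open>Image of theta_i = omega^i + omega^(-i) under the embedding of L = Q(theta) sending
  theta to theta_a (a odd).\<close>
definition theta_emb :: "nat \<Rightarrow> nat \<Rightarrow> nat \<Rightarrow> real" where
  "theta_emb m a i = 2 * cos (2 * pi * real (a * i) / 2 ^ m)"

definition w_emb :: "nat \<Rightarrow> nat \<Rightarrow> nat \<Rightarrow> real" where
  "w_emb m a i = 1 + (\<Sum>t\<in>{1..i}. theta_emb m a t)"

definition beta_emb :: "nat \<Rightarrow> nat \<Rightarrow> nat \<Rightarrow> real" where
  "beta_emb p m a = (1 / real (2 ^ (m - 2)) - theta_emb m a 1 / (2 * real (2 ^ (m - 2))))
                     / real p ^ 2"

text \<open>An element y of KL is represented by the family of its real embeddings
  emb s a = (sigma^s, theta -> theta_a)(y), for 0 <= s < l and a odd.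
  The n = k*l coordinates are ordered by c = s * k + j, with a = 2 j + 1 (0 <= j < k);
  the a = 2j+1, j < k, run through all k embeddings of L.
  phi_beta(y) as a vector in R^n (zero beyond n).\<close>
definition phi_vec :: "nat \<Rightarrow> nat \<Rightarrow> nat \<Rightarrow> (nat \<Rightarrow> nat \<Rightarrow> real) \<Rightarrow> nat \<Rightarrow> real" where
  "phi_vec p l m emb = (\<lambda>c. if c < 2 ^ (m - 2) * l then
       sqrt (beta_emb p m (2 * (c mod 2 ^ (m - 2)) + 1))
         * emb (c div 2 ^ (m - 2)) (2 * (c mod 2 ^ (m - 2)) + 1)
     else 0)"

definition gens_M :: "nat \<Rightarrow> nat \<Rightarrow> nat \<Rightarrow> int \<Rightarrow> nat \<Rightarrow> (nat \<Rightarrow> nat \<Rightarrow> real) set" where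
  "gens_M p l r lam m =
     {(\<lambda>s a. w_emb m a 0 * (sig_x p l r lam s + sig_x p l r lam (s + 1)))}
     \<union> {(\<lambda>s a. w_emb m a i * sig_x p l r lam (s + (l - 1))
                 - w_emb m a (i + 1) * sig_x p l r lam s) | i. i + 2 \<le> 2 ^ (m - 2)}
     \<union> {(\<lambda>s a. w_emb m a j * (sig_x p l r lam (s + i) - sig_x p l r lam (s + i + 1)))
          | i j. j < 2 ^ (m - 2) \<and> i + 2 \<le> l}"

definition int_span :: "(nat \<Rightarrow> real) set \<Rightarrow> (nat \<Rightarrow> real) set" where
  "int_span S = {v. \<exists>F c. finite F \<and> F \<subseteq> S \<and>
                      v = (\<lambda>t. \<Sum>g\<in>F. of_int (c g) * g t)}"

definition lattice_M :: "nat \<Rightarrow> nat \<Rightarrow> nat \<Rightarrow> int \<Rightarrow> nat \<Rightarrow> (nat \<Rightarrow> real) set" where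
  "lattice_M p l r lam m = int_span (phi_vec p l m ` gens_M p l r lam m)"

definition D_lattice :: "nat \<Rightarrow> (nat \<Rightarrow> int) set" where
  "D_lattice n = {y. (\<forall>c\<ge>n. y c = 0) \<and> even (\<Sum>c<n. y c)}"

definition orthogonal_nat_mat :: "nat \<Rightarrow> (nat \<Rightarrow> nat \<Rightarrow> real) \<Rightarrow> bool" where
  "orthogonal_nat_mat n Q \<longleftrightarrow>
     (\<forall>i<n. \<forall>j<n. (\<Sum>c<n. Q i c * Q j c) = (if i = j then 1 else 0))"

definition row_times :: "nat \<Rightarrow> (nat \<Rightarrow> int) \<Rightarrow> (nat \<Rightarrow> nat \<Rightarrow> real) \<Rightarrow> nat \<Rightarrow> real" where
  "row_times n y Q = (\<lambda>c. if c < n then (\<Sum>i<n. of_int (y i) * Q i c) else 0)"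

end

(*
  The factor u = zeta^lambda * alpha satisfies sigma(u) = -u and |u|^2 = p, so sigma^t(x) is -u
  times the alternating Gaussian period sum_j (-1)^(jl+t) zeta^(r^(jl+t)). Since the signs cancel
  over a period, sum_s sigma^(s+a)(x) sigma^(s+b)(x) = p^2 if a = b and 0 otherwise
  (0 <= a, b < l). On the other side, with A = pi a / 2^m, one has w_i = sin((2i+1)A) / sin A and
  beta = 2 sin(A)^2 / (k p^2), so the vectors sqrt(beta) w_i are, up to the factor 1/p, the rows
  of an orthogonal discrete sine transform matrix. Hence the n vectors phi(w_i sigma^t(x)) are
  orthonormal; numbering them f_q with q = i l + t, the generators of M become f_0 + f_1 and
  f_q - f_(q+1), the standard basis of D_n.
*)
theory Submission
  imports Defs "HOL-Computational_Algebra.Polynomial"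
begin

section \<open>Roots of unity and additive characters modulo \<open>p\<close>\<close>

lemma zpow_0 [simp]: "zpow p 0 = 1"
  by (simp add: zpow_def)

lemma zpow_add: "zpow p (a + b) = zpow p a * zpow p b"
  by (simp add: zpow_def cis_mult ring_distribs add_divide_distrib)

lemma zpow_uminus: "zpow p (- a) = cnj (zpow p a)"
  by (simp add: zpow_def cis_cnj)

lemma norm_zpow [simp]: "norm (zpow p a) = 1"
  by (simp add: zpow_def)

lemma zpow_mult_cnj: "zpow p a * cnj (zpow p a) = 1"
  by (simp flip: zpow_uminus zpow_add)

lemma zpow_power: "zpow p a ^ n = zpow p (a * int n)"
  by (induction n) (simp_all add: zpow_add ring_distribs)

lemma zpow_eq_1_iff:
  assumes "p > 0"
  shows "zpow p a = 1 \<longleftrightarrow> int p dvd a"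
proof
  assume "zpow p a = 1"
  then obtain k :: int where "2 * pi * of_int a / of_nat p = of_int k * 2 * pi"
    by (auto simp: zpow_def complex_eq_iff cos_one_2pi_int)
  hence "of_int a = (of_int (k * int p) :: real)"
    using assms by (simp add: field_simps)
  hence "a = k * int p" by (simp only: of_int_eq_iff)
  thus "int p dvd a" by simp
next
  assume "int p dvd a"
  then obtain k where "a = int p * k" by auto
  hence "2 * pi * of_int a / of_nat p = 2 * pi * of_int k"
    using assms by simp
  hence "zpow p a = cis (2 * pi * of_int k)"
    by (simp only: zpow_def)
  also have "\<dots> = 1" by (rule cis_multiple_2pi) simp
  finally show "zpow p a = 1" .
qed

lemma zpow_eq_iff:
  assumes "p > 0"
  shows "zpow p a = zpow p b \<longleftrightarrow> [a = b] (mod int p)"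
proof -
  have "zpow p a = zpow p b * zpow p (a - b)"
    by (simp flip: zpow_add)
  moreover have "zpow p b \<noteq> 0" by (metis norm_zpow norm_zero zero_neq_one)
  ultimately have "zpow p a = zpow p b \<longleftrightarrow> zpow p (a - b) = 1" by simp
  thus ?thesis using zpow_eq_1_iff[OF assms] by (simp add: cong_iff_dvd_diff)
qed

lemma zpow_cong: "p > 0 \<Longrightarrow> [a = b] (mod int p) \<Longrightarrow> zpow p a = zpow p b"
  by (simp add: zpow_eq_iff)

text \<open>Geometric sum whose ratio has \<open>p\<close>-th power 1. This orthogonality of
  additive characters later evaluates the correlations of the periods.\<close>

lemma sum_zpow_mult:
  assumes "p > 0"
  shows "(\<Sum>y<p. zpow p (d * int y)) = (if int p dvd d then of_nat p else 0)"
proof (cases "int p dvd d")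
  case True
  hence "zpow p (d * int y) = 1" for y
    using assms by (simp add: zpow_eq_1_iff)
  thus ?thesis using True by simp
next
  case False
  have "(\<Sum>y<p. zpow p (d * int y)) = (\<Sum>y<p. zpow p d ^ y)"
    by (simp add: zpow_power)
  also have "\<dots> = (zpow p d ^ p - 1) / (zpow p d - 1)"
    using False assms by (intro geometric_sum) (simp add: zpow_eq_1_iff)
  also have "zpow p d ^ p = 1"
    using assms by (simp add: zpow_power zpow_eq_1_iff)
  finally show ?thesis using False by simp
qed

text \<open>Evaluation at 1 of the factorization of 1 + X + ... + X^(p-1) into the linear factors X
  - zeta^y with 0 < y < p. It later yields |u|^2 = p.\<close>

lemma prod_one_minus_zpow:
  assumes "p > 0"
  shows "(\<Prod>y\<in>{1..<p}. 1 - zpow p (int y)) = of_nat p"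
proof -
  define f where "f = (\<lambda>y. zpow p (int y))"
  define P where "P = (\<Sum>i<p. monom (1::complex) i)"
  define R where "R = (\<Prod>y\<in>{1..<p}. [:- f y, 1:])"
  have inj: "inj_on f {1..<p}"
  proof (rule inj_onI)
    fix x y assume "x \<in> {1..<p}" "y \<in> {1..<p}" "f x = f y"
    thus "x = y"
      using assms cong_less_modulus_unique_nat[of x y p]
      by (simp add: f_def zpow_eq_iff cong_int_iff)
  qed
  have degR: "degree R = p - 1" unfolding R_def
    by (subst degree_prod_eq_sum_degree) auto
  have "lead_coeff R = 1" unfolding R_def by (subst lead_coeff_prod) simp
  have "P = R"
  \<comment> \<open>Equal coefficients at \<open>p - 1\<close> leave a difference of degree below
    \<open>p - 1\<close>, which cannot vanish at \<open>p - 1\<close> distinct points unless it is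
    zero.\<close>
  proof (rule poly_eqI_degree_lead_coeff[where n = "p - 1" and A = "f ` {1..<p}"])
    have "coeff P (p - 1) = 1" using assms by (simp add: P_def coeff_sum)
    thus "coeff P (p - 1) = coeff R (p - 1)"
      using \<open>lead_coeff R = 1\<close> degR by simp
    show "card (f ` {1..<p}) \<ge> p - 1" using card_image[OF inj] by simp
    show "degree P \<le> p - 1" unfolding P_def
      by (intro degree_sum_le) (auto intro!: order.trans[OF degree_monom_le])
    show "degree R \<le> p - 1" by (simp add: degR)
  next
    fix z assume "z \<in> f ` {1..<p}"
    then obtain y where y: "y \<in> {1..<p}" "z = f y" by auto
    have "poly P z = (\<Sum>i<p. zpow p (int y * int i))"
      by (simp add: P_def poly_sum poly_monom y f_def zpow_power)
    also have "\<dots> = 0"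
      using y by (subst sum_zpow_mult) (auto dest: nat_dvd_not_less)
    also have "0 = poly R z" using y by (auto simp: R_def poly_prod)
    finally show "poly P z = poly R z" .
  qed
  hence "poly R 1 = poly P 1" by simp
  also have "poly P 1 = of_nat p" by (simp add: P_def poly_sum poly_monom)
  finally show ?thesis by (simp add: R_def poly_prod f_def)
qed

section \<open>Shifting and regrouping finite sums\<close>

lemma sum_periodic_shift:
  fixes G :: "nat \<Rightarrow> 'a :: ab_group_add"
  assumes "\<And>j. G (j + N) = G j"
  shows "(\<Sum>j<N. G (j + c)) = (\<Sum>j<N. G j)"
proof (induction c)
  case (Suc c)
  \<comment> \<open>Moving the window by one loses \<open>G c\<close> and gains
    \<open>G (c + N)\<close>, which periodicity makes equal.\<close>
  have "(\<Sum>j<N. G (j + Suc c)) + G c = (\<Sum>j<Suc N. G (j + c))"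
    by (subst sum.lessThan_Suc_shift) (simp add: add.commute)
  also have "\<dots> = (\<Sum>j<N. G (j + c)) + G c"
    using assms[of c] by (simp add: add.commute)
  finally show ?case using Suc by simp
qed simp

lemma sum_mult_nat:
  fixes f :: "nat \<Rightarrow> 'a :: comm_monoid_add"
  shows "(\<Sum>e<n * k. f e) = (\<Sum>j<n. \<Sum>s<k. f (j * k + s))"
proof -
  have "(\<Sum>e<n * k. f e) = (\<Sum>j<n. sum f {j * k..<j * k + k})"
    by (rule sum.nat_group [symmetric])
  also have "\<dots> = (\<Sum>j<n. \<Sum>s<k. f (j * k + s))"
  proof (rule sum.cong[OF refl])
    show "sum f {j * k..<j * k + k} = (\<Sum>s<k. f (j * k + s))" for j
      using sum.shift_bounds_nat_ivl[of f 0 "j * k" k]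
      by (simp add: lessThan_atLeast0 add.commute)
  qed
  finally show ?thesis .
qed

section \<open>Integer spans and the standard basis of D_n\<close>

lemma int_span_subset: "S \<subseteq> int_span S"
proof
  fix g assume "g \<in> S"
  thus "g \<in> int_span S"
    unfolding int_span_def by (auto intro!: exI[of _ "{g}"] exI[of _ "\<lambda>_. 1"])
qed

lemma int_span_0: "(\<lambda>_. 0) \<in> int_span S"
  unfolding int_span_def by (auto intro!: exI[of _ "{}"])

lemma int_span_add_smult:
  assumes "u \<in> int_span S" "v \<in> int_span S"
  shows "(\<lambda>t. u t + of_int k * v t) \<in> int_span S"
proof -
  obtain F c where u: "finite F" "F \<subseteq> S" "u = (\<lambda>t. \<Sum>g\<in>F. of_int (c g) * g t)"
    using assms(1) unfolding int_span_def by blast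
  obtain G d where v: "finite G" "G \<subseteq> S" "v = (\<lambda>t. \<Sum>g\<in>G. of_int (d g) * g t)"
    using assms(2) unfolding int_span_def by blast
  define e where "e g = (if g \<in> F then c g else 0) + k * (if g \<in> G then d g else 0)" for g
  have ext: "(\<Sum>g\<in>A. of_int (b g) * g t) =
      (\<Sum>g\<in>F \<union> G. of_int (if g \<in> A then b g else 0) * g t)"
    if "A \<subseteq> F \<union> G" for A b and t :: nat
    using that u(1) v(1) by (intro sum.mono_neutral_cong_left) auto
  have "u t + of_int k * v t = (\<Sum>g\<in>F \<union> G. of_int (e g) * g t)" for t
    unfolding u(3) v(3) ext[of F c, OF Un_upper1] ext[of G d, OF Un_upper2]
    by (simp add: e_def sum_distrib_left sum.distrib algebra_simps)
  moreover have "finite (F \<union> G)" "F \<union> G \<subseteq> S" using u v by auto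
  ultimately show ?thesis unfolding int_span_def by blast
qed

lemma int_span_sum:
  assumes "\<And>i. i \<in> I \<Longrightarrow> f i \<in> int_span S"
  shows "(\<lambda>t. \<Sum>i\<in>I. of_int (c i) * f i t) \<in> int_span S"
  using assms
proof (induction I rule: infinite_finite_induct)
  case (insert i I)
  hence "(\<lambda>t. (\<Sum>i\<in>I. of_int (c i) * f i t) + of_int (c i) * f i t) \<in> int_span S"
    by (intro int_span_add_smult) auto
  with insert show ?case by (simp add: add.commute)
qed (auto simp: int_span_0)

lemma int_span_least:
  assumes "S \<subseteq> T" "(\<lambda>_. 0) \<in> T"
    and "\<And>u v k. u \<in> T \<Longrightarrow> v \<in> T \<Longrightarrow> (\<lambda>t. u t + of_int k * v t) \<in> T"
  shows "int_span S \<subseteq> T"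
proof
  fix v assume "v \<in> int_span S"
  then obtain F c where v: "finite F" "F \<subseteq> S" "v = (\<lambda>t. \<Sum>g\<in>F. of_int (c g) * g t)"
    unfolding int_span_def by blast
  have "(\<lambda>t. \<Sum>g\<in>F. of_int (c g) * g t) \<in> T"
    using v(1,2)
  proof (induction F)
    case (insert g F)
    hence "(\<lambda>t. (\<Sum>g\<in>F. of_int (c g) * g t) + of_int (c g) * g t) \<in> T"
      using assms(1) by (intro assms(3)) auto
    with insert show ?case by (simp add: add.commute)
  qed (use assms in auto)
  thus "v \<in> T" using v by simp
qed

text \<open>Telescoping the differences gives every \<open>b q - b 0\<close>, and together with
  \<open>b 0 + b 1\<close> this gives \<open>2 * b 0\<close>. A vector with even coordinate sum is
  an integer combination of these.\<close>

lemma int_span_D_basis: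
  fixes b :: "nat \<Rightarrow> nat \<Rightarrow> real"
  assumes n: "n \<ge> 2"
  defines "B \<equiv> {\<lambda>t. b 0 t + b 1 t} \<union> {\<lambda>t. b q t - b (q + 1) t | q. q + 1 < n}"
  shows "int_span B = {\<lambda>t. \<Sum>i<n. of_int (y i) * b i t | y. y \<in> D_lattice n}"
    (is "_ = ?T")
proof
  show "int_span B \<subseteq> ?T"
  proof (rule int_span_least)
    define e :: "nat \<Rightarrow> nat \<Rightarrow> int" where "e i c = (if c = i then 1 else 0)" for i c
    have sum_e: "(\<Sum>c<n. real_of_int (e i c) * f c) = f i" if "i < n" for i f
    proof -
      have "(\<Sum>c<n. real_of_int (e i c) * f c) = (\<Sum>c<n. if c = i then f c else 0)"
        by (intro sum.cong) (auto simp: e_def)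
      thus ?thesis using that by simp
    qed
    \<comment> \<open>The coordinate sum is \<open>1 + s\<close>, even for odd \<open>s\<close>; the
      values 1 and -1 of \<open>s\<close> cover both kinds of elements of \<open>B\<close>.\<close>
    have pair: "(\<lambda>t. b i t + of_int s * b j t) \<in> ?T"
      if "i < n" "j < n" "odd s" for i j and s :: int
    proof -
      have "(\<lambda>c. e i c + s * e j c) \<in> D_lattice n"
        using that by (auto simp: D_lattice_def e_def sum.distrib simp flip: sum_distrib_left)
      moreover have "(\<Sum>c<n. of_int (e i c + s * e j c) * b c t) = b i t + of_int s * b j t" for t
        using that sum_e[of _ "\<lambda>c. b c t"]
        by (simp add: ring_distribs sum.distrib mult.assoc flip: sum_distrib_left)
      ultimately show ?thesis
        by (intro CollectI exI[of _ "\<lambda>c. e i c + s * e j c"]) (auto simp del: of_int_add)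
    qed
    show "B \<subseteq> ?T"
      using pair[of 0 1 1] pair[of _ _ "-1"] n unfolding B_def by auto
    show "(\<lambda>_. 0) \<in> ?T"
      by (auto simp: D_lattice_def intro!: exI[of _ "\<lambda>_. 0"])
    fix u v and k :: int assume "u \<in> ?T" "v \<in> ?T"
    then obtain y z where y: "y \<in> D_lattice n" "u = (\<lambda>t. \<Sum>i<n. of_int (y i) * b i t)"
      and z: "z \<in> D_lattice n" "v = (\<lambda>t. \<Sum>i<n. of_int (z i) * b i t)" by blast
    have D: "(\<lambda>i. y i + k * z i) \<in> D_lattice n"
      using y(1) z(1) by (simp add: D_lattice_def sum.distrib flip: sum_distrib_left)
    have "u t + of_int k * v t = (\<Sum>i<n. of_int (y i + k * z i) * b i t)" for t
      by (simp add: y z ring_distribs sum.distrib mult.assoc sum_distrib_left)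
    hence "(\<lambda>t. u t + of_int k * v t) = (\<lambda>t. \<Sum>i<n. of_int (y i + k * z i) * b i t)"
      by (rule ext)
    with D show "(\<lambda>t. u t + of_int k * v t) \<in> ?T"
      by (intro CollectI exI[of _ "\<lambda>i. y i + k * z i"] conjI)
  qed
next
  have diff: "(\<lambda>t. b q t - b 0 t) \<in> int_span B" if "q < n" for q
    using that
  proof (induction q)
    case 0
    show ?case using int_span_0 by simp
  next
    case (Suc q)
    have "(\<lambda>t. b q t - b (q + 1) t) \<in> int_span B"
      using Suc.prems int_span_subset by (fastforce simp: B_def)
    from int_span_add_smult[OF Suc.IH this, of "-1"] Suc.prems show ?case by simp
  qed
  have "(\<lambda>t. b 0 t + b 1 t) \<in> int_span B"
    using int_span_subset by (fastforce simp: B_def)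
  \<comment> \<open>The combination is (b 0 + b 1) - (b 1 - b 0).\<close>
  from int_span_add_smult[OF this diff[of 1], of "-1"] n
  have two: "(\<lambda>t. 2 * b 0 t) \<in> int_span B" by simp
  show "?T \<subseteq> int_span B"
  proof
    fix v assume "v \<in> ?T"
    then obtain y where y: "y \<in> D_lattice n" "v = (\<lambda>t. \<Sum>i<n. of_int (y i) * b i t)"
      by blast
    then obtain h where h: "(\<Sum>i<n. y i) = 2 * h" by (auto simp: D_lattice_def)
    \<comment> \<open>Replacing each \<open>b i\<close> by \<open>b i - b 0\<close> removes
      \<open>b 0\<close> with total weight \<open>2 * h\<close>, which the last term
      restores.\<close>
    have "(\<lambda>t. (\<Sum>i<n. of_int (y i) * (b i t - b 0 t)) + of_int h * (2 * b 0 t)) \<in> int_span B"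
      by (rule int_span_add_smult[OF int_span_sum two]) (simp add: diff)
    moreover have "(\<Sum>i<n. of_int (y i) * (b i t - b 0 t)) + of_int h * (2 * b 0 t) = v t" for t
    proof -
      have "of_int h * (2 * b 0 t) = (\<Sum>i<n. of_int (y i)) * b 0 t"
        by (simp add: h flip: of_int_sum)
      thus ?thesis
        by (simp add: y(2) ring_distribs sum_subtractf sum_distrib_right)
    qed
    ultimately show "v \<in> int_span B" by simp
  qed
qed

section \<open>The primitive root modulo \<open>p\<close> and the factor zeta^lambda * alpha\<close>

locale primroot_setup =
  fixes l p r :: nat and lam :: int
  assumes odd_l: "odd l" and l_gt_1: "l > 1"
    and prime_p: "prime p" and p_cong: "[p = 1] (mod l)"
    and primroot: "residue_primroot p r"
    and lam: "[lam * (int r - 1) = 1] (mod int p)"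
begin

definition N :: nat where "N = (p - 1) div l"

lemma p_gt_2: "p > 2"
proof -
  have "p \<noteq> 2"
  proof
    assume "p = 2"
    moreover have "l > 2" using odd_l l_gt_1 by (cases "l = 2") auto
    ultimately show False using p_cong by (simp add: Cong.cong_def)
  qed
  thus ?thesis using prime_gt_1_nat[OF prime_p] by linarith
qed

lemma p_pos: "p > 0"
  using p_gt_2 by simp

lemma even_p_minus_1: "even (p - 1)"
  using prime_odd_nat[OF prime_p] p_gt_2 by simp

lemma N_mult_l: "N * l = p - 1"
proof -
  have "l dvd p - 1"
    using p_cong p_gt_2 cong_altdef_nat[of 1 p l] by (auto simp: cong_sym_eq)
  thus ?thesis by (simp add: N_def)
qed

lemma N_pos: "N > 0"
  using N_mult_l p_gt_2 by (cases "N = 0") auto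

text \<open>As \<open>l\<close> is odd, every factor 2 of \<open>p - 1\<close> lies in
  \<open>N\<close>. This makes alternating signs cancel over a period and makes (p-1)/2 a multiple
  of \<open>l\<close>.\<close>

lemma even_N: "even N"
  using N_mult_l even_p_minus_1 odd_l by (metis even_mult_iff)

lemma coprime_p_r: "coprime p r" and ord_r: "ord p r = p - 1"
  using primroot prime_p by (auto simp: residue_primroot_def totient_prime)

lemma r_power_cong_iff: "[r ^ a = r ^ b] (mod p) \<longleftrightarrow> [a = b] (mod (p - 1))"
  using order_divides_expdiff[OF coprime_p_r] ord_r by simp

lemma not_dvd_r_power: "\<not> int p dvd int r ^ t"
proof -
  have "\<not> p dvd r"
    using coprime_p_r prime_p by (meson not_prime_unit coprime_common_divisor dvd_refl)
  hence "\<not> p dvd r ^ t" using prime_p prime_dvd_power by blast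
  thus ?thesis by (simp flip: of_nat_power)
qed

definition h :: nat where "h = (p - 1) div 2"

lemma h_mult_2: "h * 2 = p - 1"
  using even_p_minus_1 by (simp add: h_def)

text \<open>\<open>r ^ h\<close> is a square root of 1 modulo the prime \<open>p\<close>, and it is
  not 1 because \<open>r\<close> has order \<open>p - 1\<close>.\<close>

lemma r_power_h: "[int r ^ h = - 1] (mod int p)"
proof -
  have "[r ^ (p - 1) = 1] (mod p)" using ord_r by (simp add: ord_divides')
  hence "[int r ^ (p - 1) = 1] (mod int p)"
    by (simp flip: of_nat_power cong_int_iff)
  hence "int p dvd (int r ^ h - 1) * (int r ^ h + 1)"
    unfolding h_mult_2[symmetric] by (simp add: cong_iff_dvd_diff algebra_simps power_mult power2_eq_square)
  hence "int p dvd int r ^ h - 1 \<or> int p dvd int r ^ h + 1"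
    using prime_p by (simp add: prime_dvd_mult_iff)
  moreover have "\<not> int p dvd int r ^ h - 1"
  proof
    assume "int p dvd int r ^ h - 1"
    hence "[int (r ^ h) = int 1] (mod int p)" by (simp add: cong_iff_dvd_diff)
    hence "p - 1 dvd h" unfolding cong_int_iff using ord_r by (simp add: ord_divides')
    thus False using h_mult_2 p_gt_2 dvd_imp_le[of "p - 1" h] by (cases "h = 0") auto
  qed
  ultimately show ?thesis by (simp add: cong_iff_dvd_diff)
qed

lemma bij_betw_r_power: "bij_betw (\<lambda>e. r ^ e mod p) {..<p - 1} {1..<p}"
proof -
  have "totatives p = {1..<p}"
    by (auto simp: totatives_prime[OF prime_p])
  moreover have "1 < p" using p_gt_2 by simp
  ultimately show ?thesis
    using residue_primroot_is_generator[OF _ primroot] by (simp only: totient_prime[OF prime_p])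
qed

lemma zpow_r_power_mod: "zpow p (d * int (r ^ e mod p)) = zpow p (d * int r ^ e)"
  using p_pos by (intro zpow_cong cong_mult) (auto simp: zmod_int Cong.cong_def)

text \<open>The powers of \<open>r\<close> run through the nonzero residues, so this is the full
  character sum without its term 1 at residue 0.\<close>

lemma sum_zpow_r_power:
  "(\<Sum>e<p - 1. zpow p (d * int r ^ e)) = (if int p dvd d then of_nat p else 0) - 1"
proof -
  have "(\<Sum>e<p - 1. zpow p (d * int r ^ e)) = (\<Sum>y\<in>{1..<p}. zpow p (d * int y))"
    unfolding zpow_r_power_mod[symmetric]
    by (rule sum.reindex_bij_betw[OF bij_betw_r_power])
  also have "\<dots> = (\<Sum>y<p. zpow p (d * int y)) - 1"
    using p_pos by (simp add: lessThan_atLeast0 sum.atLeast_Suc_lessThan)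
  finally show ?thesis by (simp add: sum_zpow_mult[OF p_pos])
qed

text \<open>The conjugate \<open>\<sigma>\<^sup>t(\<zeta>\<^sub>p\<^sup>\<lambda> \<alpha>)\<close>.\<close>

definition u :: "nat \<Rightarrow> complex" where
  "u t = zpow p (lam * int r ^ t) * (\<Prod>j<h. 1 - zpow p (int r ^ (j + t)))"

lemma sig_z_eq: "sig_z p r lam t = u t * (1 - zpow p (int r ^ t))"
  by (simp add: sig_z_def u_def h_def)

text \<open>The automorphism sigma^h is complex conjugation, because \<open>r ^ h\<close> is -1
  modulo \<open>p\<close>.\<close>

lemma zpow_h: "zpow p (int r ^ (t + h)) = cnj (zpow p (int r ^ t))"
proof -
  have "[int r ^ (t + h) = int r ^ t * (- 1)] (mod int p)"
    unfolding power_add by (intro cong_mult r_power_h cong_refl)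
  hence "zpow p (int r ^ (t + h)) = zpow p (int r ^ t * (- 1))"
    by (rule zpow_cong[OF p_pos])
  thus ?thesis by (simp add: zpow_uminus)
qed

text \<open>With \<zeta> the \<open>t\<close>-th conjugate of zeta_p, shifting the product trades
  the factor 1 - \<zeta> for its conjugate, that is, multiplies it by minus the conjugate of
  \<zeta>. The choice of \<open>lam\<close> makes the prefactor gain exactly \<zeta>, so only the
  sign remains.\<close>

lemma u_Suc: "u (Suc t) = - u t"
proof -
  define f where "f = (\<lambda>e. 1 - zpow p (int r ^ e))"
  define \<zeta> where "\<zeta> = zpow p (int r ^ t)"
  have cnj: "\<zeta> * cnj \<zeta> = 1"
    by (simp add: \<zeta>_def zpow_mult_cnj)
  have nz: "f t \<noteq> 0"
    using not_dvd_r_power[of t] by (simp add: f_def zpow_eq_1_iff[OF p_pos] eq_commute[of 1])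
  \<comment> \<open>Both products are completed to the window of length \<open>h + 1\<close>, on the
    left by its first factor and on the right by its last.\<close>
  have "f t * (\<Prod>j<h. f (j + Suc t)) = (\<Prod>j<Suc h. f (j + t))"
    by (subst prod.lessThan_Suc_shift) simp
  also have "\<dots> = f (t + h) * (\<Prod>j<h. f (j + t))"
    by (simp add: add.commute)
  also have "f (t + h) = 1 - cnj \<zeta>"
    by (simp add: f_def zpow_h \<zeta>_def)
  also have "\<dots> = - cnj \<zeta> * f t"
    using cnj by (simp add: f_def \<zeta>_def algebra_simps)
  finally have prod: "(\<Prod>j<h. f (j + Suc t)) = - cnj \<zeta> * (\<Prod>j<h. f (j + t))"
    unfolding mult.assoc[of _ "f t"] mult.left_commute[of _ "f t"] mult_left_cancel[OF nz] .
  have "[lam * (int r - 1) * int r ^ t = 1 * int r ^ t] (mod int p)"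
    by (intro cong_mult lam cong_refl)
  hence "zpow p (lam * (int r - 1) * int r ^ t) = \<zeta>"
    unfolding \<zeta>_def by (intro zpow_cong p_pos) simp
  hence "zpow p (lam * int r ^ Suc t) = zpow p (lam * int r ^ t) * \<zeta>"
    using zpow_add[of p "lam * int r ^ t" "lam * (int r - 1) * int r ^ t"]
    by (simp add: algebra_simps)
  hence "u (Suc t) = zpow p (lam * int r ^ t) * \<zeta> * (- cnj \<zeta> * (\<Prod>j<h. f (j + t)))"
    using prod by (simp add: u_def f_def)
  also have "\<dots> = - (\<zeta> * cnj \<zeta>) * u t"
    by (simp add: u_def f_def)
  finally show ?thesis using cnj by simp
qed

lemma u_eq: "u t = (- 1) ^ t * u 0"
  by (induction t) (simp_all add: u_Suc)

text \<open>Conjugation shifts the exponents by \<open>h\<close>, so alpha and its conjugate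
  together contain each factor 1 - zeta^y with \<open>y\<close> a nonzero residue exactly
  once.\<close>

lemma u_mult_cnj: "u 0 * cnj (u 0) = of_nat p"
proof -
  define f where "f = (\<lambda>e. 1 - zpow p (int r ^ e))"
  have cnj_f: "cnj (f e) = f (e + h)" for e
    by (simp add: f_def zpow_h)
  have "u 0 * cnj (u 0) = (zpow p lam * cnj (zpow p lam)) * ((\<Prod>j<h. f j) * cnj (\<Prod>j<h. f j))"
    by (simp add: u_def f_def)
  also have "zpow p lam * cnj (zpow p lam) = 1"
    by (rule zpow_mult_cnj)
  also have "cnj (\<Prod>j<h. f j) = (\<Prod>j=h..<h + h. f j)"
    unfolding cnj_prod cnj_f using prod.shift_bounds_nat_ivl[of f 0 h h]
    by (simp add: lessThan_atLeast0)
  also have "(\<Prod>j<h. f j) * (\<Prod>j=h..<h + h. f j) = (\<Prod>j<p - 1. f j)"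
    unfolding h_mult_2[symmetric] mult_2_right lessThan_atLeast0 by (rule prod.atLeastLessThan_concat) auto
  also have "\<dots> = (\<Prod>y\<in>{1..<p}. 1 - zpow p (int y))"
    using prod.reindex_bij_betw[OF bij_betw_r_power, of "\<lambda>y. 1 - zpow p (int y)"]
      zpow_r_power_mod[of 1] by (simp add: f_def)
  finally show ?thesis using prod_one_minus_zpow[OF p_pos] by simp
qed

section \<open>Alternating Gaussian periods and their correlations\<close>

definition F :: "nat \<Rightarrow> complex" where
  "F e = (- 1) ^ e * zpow p (int r ^ e)"

text \<open>The sign \<open>(- 1) ^ e\<close> is the quadratic character of \<open>r ^ e\<close>; it
  depends only on \<open>e\<close> modulo \<open>p - 1\<close> because \<open>p - 1\<close> is
  even.\<close>

lemma F_periodic: "F (e + (p - 1)) = F e"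
proof -
  have "[r ^ (e + (p - 1)) = r ^ e] (mod p)"
    unfolding r_power_cong_iff by (simp add: Cong.cong_def)
  hence "zpow p (int r ^ (e + (p - 1))) = zpow p (int r ^ e)"
    by (intro zpow_cong p_pos) (simp flip: of_nat_power cong_int_iff)
  thus ?thesis using even_p_minus_1 by (simp add: F_def power_add)
qed

lemma F_h: "F (e + h) = (- 1) ^ h * cnj (F e)"
  unfolding F_def zpow_h by (simp add: power_add)

text \<open>The conjugate \<open>\<sigma>\<^sup>t(x)\<close>; see \<open>sum_sig_z\<close>.\<close>

definition X :: "nat \<Rightarrow> complex" where
  "X t = - u 0 * (\<Sum>j<N. F (j * l + t))"

lemma sum_F_shift: "(\<Sum>j<N. F ((j + c) * l + t)) = (\<Sum>j<N. F (j * l + t))"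
proof (rule sum_periodic_shift)
  show "F ((j + N) * l + t) = F (j * l + t)" for j
    using F_periodic[of "j * l + t"] by (simp add: add_mult_distrib N_mult_l add_ac)
qed

lemma sum_sign_eq_0:
  assumes "even M"
  shows "(\<Sum>j<M. (- 1 :: complex) ^ j) = 0"
  using assms by (elim evenE) (simp add: sum_gp_strict)

text \<open>PLACEHOLDER

  The constant parts \<open>u 0 * (- 1) ^ (j + t)\<close> cancel because \<open>N\<close> is even,
  and only the periods built from \<open>F\<close> survive.\<close>

lemma sum_sig_z: "(\<Sum>j\<in>{1..N}. sig_z p r lam (j * l + t)) = X t"
proof -
  have sgn: "(- 1 :: complex) ^ (j * l + t) = (- 1) ^ (j + t)" for j
    using odd_l by (simp add: power_add mult.commute[of j] power_mult)
  have sig_z: "sig_z p r lam (j * l + t) = u 0 * ((- 1) ^ (j + t) - F (j * l + t))" for j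
    unfolding sgn[of j, symmetric] sig_z_eq F_def u_eq[of "j * l + t"] by (simp add: algebra_simps)
  have "(\<Sum>j\<in>{1..N}. sig_z p r lam (j * l + t)) = (\<Sum>j<N. sig_z p r lam ((j + 1) * l + t))"
    by (rule sum.reindex_bij_witness[of _ "\<lambda>j. j + 1" "\<lambda>j. j - 1"]) auto
  \<comment> \<open>The definition of x starts at index 1; the shift back to 0 is absorbed at the
    end by the periodicity of \<open>F\<close>.\<close>
  also have "\<dots> = (\<Sum>j<N. u 0 * ((- 1) ^ (j + 1 + t) - F ((j + 1) * l + t)))"
    by (simp only: sig_z)
  also have "\<dots> = u 0 * ((- 1) ^ Suc t * (\<Sum>j<N. (- 1) ^ j) - (\<Sum>j<N. F ((j + 1) * l + t)))"
    by (simp add: sum_subtractf sum_distrib_left algebra_simps power_add)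
  also have "\<dots> = X t"
    by (simp add: sum_sign_eq_0[OF even_N] sum_F_shift[of 1, simplified] X_def)
  finally show ?thesis .
qed

text \<open>Conjugation gives both \<open>u 0\<close> and the shifted \<open>F\<close> the sign
  \<open>(- 1) ^ h\<close>, so the signs cancel. The shift by \<open>h\<close> is a whole number of
  steps of length \<open>l\<close> and permutes the period.\<close>

lemma cnj_X: "cnj (X t) = X t"
proof -
  have h: "h = (N div 2) * l"
    using N_mult_l h_mult_2 even_N by (elim evenE) auto
  have "cnj (u 0) = u h"
  proof -
    have "[lam * int r ^ h = lam * (- 1)] (mod int p)"
      by (intro cong_mult r_power_h cong_refl)
    hence "zpow p (lam * int r ^ h) = cnj (zpow p lam)"
      using zpow_cong[OF p_pos] by (fastforce simp flip: zpow_uminus)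
    thus ?thesis
      by (simp add: u_def zpow_h)
  qed
  hence u: "cnj (u 0) = (- 1) ^ h * u 0" by (simp add: u_eq[of h])
  have F: "cnj (F e) = (- 1) ^ h * F (e + h)" for e
    using F_h[of e] by (simp flip: power_add mult.assoc)
  have "cnj (X t) = - (((- 1) ^ h * (- 1) ^ h) * u 0 * (\<Sum>j<N. F (j * l + t + h)))"
    by (simp add: X_def u F sum_distrib_left sum_negf mult_ac)
  also have "(- 1 :: complex) ^ h * (- 1) ^ h = 1"
    by (simp flip: power_add)
  also have "(\<Sum>j<N. F (j * l + t + h)) = (\<Sum>j<N. F (j * l + t))"
    using sum_F_shift[of "N div 2" t] by (simp add: h algebra_simps)
  finally show ?thesis by (simp add: X_def)
qed

text \<open>The sum is fixed by conjugation, so taking \<open>Re\<close> in \<open>sig_x\<close>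
  discards nothing.\<close>

lemma of_real_sig_x: "of_real (sig_x p l r lam t) = X t"
proof -
  have "sig_x p l r lam t = Re (X t)"
    using sum_sig_z[of t] by (simp add: sig_x_def N_def)
  thus ?thesis using cnj_X[of t] by (simp add: complex_eq_iff)
qed

text \<open>The signs combine to one independent of \<open>e\<close>, which leaves the character sum
  for the difference of \<open>r ^ a\<close> and \<open>r ^ b\<close>.\<close>

lemma sum_F_correlation:
  "(\<Sum>e<p - 1. F (e + a) * cnj (F (e + b))) =
     (- 1) ^ (a + b) * ((if [a = b] (mod (p - 1)) then of_nat p else 0) - 1)"
proof -
  have "F (e + a) * cnj (F (e + b)) =
      (- 1) ^ (a + b) * zpow p ((int r ^ a - int r ^ b) * int r ^ e)" for e
  proof -
    have "F (e + a) * cnj (F (e + b)) = (- 1) ^ (e + a) * (- 1) ^ (e + b) *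
        (zpow p (int r ^ (e + a)) * cnj (zpow p (int r ^ (e + b))))"
      by (simp add: F_def)
    also have "(- 1 :: complex) ^ (e + a) * (- 1) ^ (e + b) = (- 1) ^ (a + b)"
      by (simp add: power_add)
    also have "zpow p (int r ^ (e + a)) * cnj (zpow p (int r ^ (e + b))) =
        zpow p ((int r ^ a - int r ^ b) * int r ^ e)"
      unfolding zpow_uminus[symmetric] zpow_add[symmetric]
      by (simp add: power_add algebra_simps)
    finally show ?thesis .
  qed
  moreover have "int p dvd int r ^ a - int r ^ b \<longleftrightarrow> [a = b] (mod (p - 1))"
    unfolding r_power_cong_iff[symmetric]
    by (simp add: cong_iff_dvd_diff flip: cong_int_iff)
  ultimately show ?thesis
    by (simp add: sum_zpow_r_power sum_distrib_left [symmetric] del: One_nat_def)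
qed

text \<open>One factor \<open>p\<close> comes from |u|^2, the other from the peak of the correlation
  of \<open>F\<close>; its off-peak values cancel by alternating signs.\<close>

lemma sum_X_correlation:
  assumes "a < l" "b < l"
  shows "(\<Sum>s<l. X (s + a) * cnj (X (s + b))) = (if a = b then of_nat (p ^ 2) else 0)"
proof -
  have X_mult: "X t * cnj (X t') =
      of_nat p * (\<Sum>i<N. \<Sum>j<N. F (j * l + i * l + t) * cnj (F (j * l + t')))" for t t'
  proof -
    have "X t * cnj (X t') =
        (u 0 * cnj (u 0)) * ((\<Sum>j<N. F (j * l + t)) * (\<Sum>j<N. cnj (F (j * l + t'))))"
      by (simp add: X_def mult_ac)
    also have "(\<Sum>j<N. F (j * l + t)) * (\<Sum>j<N. cnj (F (j * l + t'))) =
        (\<Sum>j<N. (\<Sum>i<N. F (i * l + t)) * cnj (F (j * l + t')))"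
      by (simp add: sum_distrib_left)
    \<comment> \<open>For each \<open>j\<close> the inner sum is shifted by \<open>j\<close>, so
      that \<open>i\<close> becomes the difference of the two indices.\<close>
    also have "\<dots> = (\<Sum>j<N. (\<Sum>i<N. F ((i + j) * l + t)) * cnj (F (j * l + t')))"
      by (simp add: sum_F_shift)
    also have "\<dots> = (\<Sum>j<N. \<Sum>i<N. F (j * l + i * l + t) * cnj (F (j * l + t')))"
      by (simp add: sum_distrib_left sum_distrib_right algebra_simps)
    also have "\<dots> = (\<Sum>i<N. \<Sum>j<N. F (j * l + i * l + t) * cnj (F (j * l + t')))"
      by (rule sum.swap)
    finally show ?thesis by (simp add: u_mult_cnj)
  qed
  have "(\<Sum>s<l. X (s + a) * cnj (X (s + b))) =
      of_nat p * (\<Sum>i<N. \<Sum>j<N. \<Sum>s<l.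
        F (j * l + s + (i * l + a)) * cnj (F (j * l + s + b)))"
    unfolding X_mult sum_distrib_left[symmetric]
    by (subst sum.swap, subst (2) sum.swap) (simp add: add_ac)
  \<comment> \<open>The pairs (j, s) are the digits of e = j * l + s, which runs through one full
    period \<open>N * l = p - 1\<close>.\<close>
  also have "(\<Sum>i<N. \<Sum>j<N. \<Sum>s<l. F (j * l + s + (i * l + a)) * cnj (F (j * l + s + b))) =
      (\<Sum>i<N. \<Sum>e<p - 1. F (e + (i * l + a)) * cnj (F (e + b)))"
    unfolding N_mult_l[symmetric] sum_mult_nat ..
  also have "\<dots> = (\<Sum>i<N. (- 1) ^ (a + b) * ((- 1) ^ i *
      ((if i = 0 then (if a = b then of_nat p else 0) else 0) - 1)))"
  proof (rule sum.cong[OF refl])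
    fix i assume "i \<in> {..<N}"
    hence "i * l + a < N * l"
    proof -
      have "i * l + a < (i + 1) * l" using assms by simp
      also have "\<dots> \<le> N * l" using \<open>i \<in> {..<N}\<close> by (intro mult_right_mono) auto
      finally show ?thesis .
    qed
    moreover have "b < N * l"
      using assms N_pos by (simp add: less_le_trans)
    \<comment> \<open>Both indices lie below \<open>p - 1\<close>, so congruence means
      equality.\<close>
    ultimately have "[i * l + a = b] (mod (p - 1)) \<longleftrightarrow> i * l + a = b"
      unfolding N_mult_l[symmetric] by (simp add: Cong.cong_def)
    also have "\<dots> \<longleftrightarrow> i = 0 \<and> a = b" using assms by (cases i) auto
    finally have iff: "[i * l + a = b] (mod (p - 1)) \<longleftrightarrow> i = 0 \<and> a = b" .
    have "(- 1 :: complex) ^ (i * l + a + b) = (- 1) ^ (a + b) * (- 1) ^ i"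
      using odd_l by (simp add: power_add mult.commute[of i] power_mult)
    thus "(\<Sum>e<p - 1. F (e + (i * l + a)) * cnj (F (e + b))) =
        (- 1) ^ (a + b) * ((- 1) ^ i *
          ((if i = 0 then (if a = b then of_nat p else 0) else 0) - 1))"
      unfolding sum_F_correlation iff by simp
  qed
  also have "\<dots> = (- 1) ^ (a + b) * ((\<Sum>i<N. if i = 0 then (if a = b then of_nat p else 0) else 0)
      - (\<Sum>i<N. (- 1) ^ i))"
    unfolding sum_distrib_left[symmetric] sum_subtractf[symmetric]
    by (intro arg_cong2[of _ _ _ _ "(*)"] sum.cong) auto
  \<comment> \<open>Only the peak at \<open>i = 0\<close> is left, since the constants -1 carry the
    sign \<open>(- 1) ^ i\<close>.\<close>
  also have "\<dots> = (- 1) ^ (a + b) * (if a = b then of_nat p else 0)"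
    using N_pos sum_sign_eq_0[OF even_N] by simp
  also have "\<dots> = (if a = b then of_nat p else 0)"
    by (simp flip: mult_2)
  finally show ?thesis by (simp add: power2_eq_square)
qed

lemma sum_sig_x_mult:
  assumes "a < l" "b < l"
  shows "(\<Sum>s<l. sig_x p l r lam (s + a) * sig_x p l r lam (s + b)) = (if a = b then real p ^ 2 else 0)"
proof -
  have "complex_of_real (\<Sum>s<l. sig_x p l r lam (s + a) * sig_x p l r lam (s + b)) =
      (\<Sum>s<l. X (s + a) * cnj (X (s + b)))"
    by (simp add: of_real_sig_x cnj_X)
  also have "\<dots> = of_real (if a = b then real p ^ 2 else 0)"
    using sum_X_correlation[OF assms] by simp
  finally show ?thesis by (simp only: of_real_eq_iff)
qed

end

section \<open>Orthogonality of the discrete sine vectors and the field L\<close>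

lemma sum_cos_odd_multiples:
  fixes x :: real
  shows "2 * sin x * (\<Sum>j<k. cos (real (2 * j + 1) * x)) = sin (2 * real k * x)"
proof (induction k)
  case (Suc k)
  \<comment> \<open>Each summand is a difference of consecutive values of sin(2jx), so the sum
    telescopes.\<close>
  have "2 * sin x * cos (real (2 * k + 1) * x) =
      sin (real (2 * k + 1) * x + x) - sin (real (2 * k + 1) * x - x)"
    by (simp add: sin_add sin_diff)
  also have "\<dots> = sin (2 * real (Suc k) * x) - sin (2 * real k * x)"
    by (simp add: algebra_simps)
  finally show ?case using Suc by (simp add: distrib_left)
qed simp

text \<open>With x = pi d / (2k) the telescoped value is sin(pi d) = 0, while sin x is nonzero
  because 2k does not divide d.\<close>

lemma sum_cos_odd_multiples_eq_0:
  fixes d :: int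
  assumes "d \<noteq> 0" "\<bar>d\<bar> < 2 * int k"
  shows "(\<Sum>j<k. cos (real (2 * j + 1) * (pi * of_int d / (2 * real k)))) = 0"
proof -
  define x where "x = pi * of_int d / (2 * real k)"
  have k: "k > 0" using assms by linarith
  have "sin x \<noteq> 0"
  proof
    assume "sin x = 0"
    then obtain i :: int where "x = of_int i * pi" by (auto simp: sin_zero_iff_int2)
    hence "of_int d = (of_int (i * (2 * int k)) :: real)"
      using k by (simp add: x_def field_simps)
    hence "d = i * (2 * int k)" by (simp only: of_int_eq_iff)
    hence "2 * int k dvd d" by simp
    thus False using assms zdvd_not_zless[of "\<bar>d\<bar>" "2 * int k"] by auto
  qed
  moreover have "sin (2 * real k * x) = 0"
    using k by (simp add: x_def sin_zero_iff_int2)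
  ultimately show ?thesis
    using sum_cos_odd_multiples[of x k] by (simp add: x_def)
qed

text \<open>Orthogonality of the type IV discrete sine transform: product-to-sum gives the
  frequencies i - i' and i + i' + 1, both below 2k in absolute value.\<close>

lemma sum_sin_odd_multiples_mult:
  assumes "i < k" "i' < k"
  shows "(\<Sum>j<k. sin (real (2 * i + 1) * (pi * real (2 * j + 1) / (4 * real k))) *
                  sin (real (2 * i' + 1) * (pi * real (2 * j + 1) / (4 * real k)))) =
         (if i = i' then real k / 2 else 0)"
proof -
  have k: "k > 0" using assms by simp
  define C where "C d = (\<Sum>j<k. cos (real (2 * j + 1) * (pi * of_int d / (2 * real k))))" for d
  have "sin (real (2 * i + 1) * (pi * real (2 * j + 1) / (4 * real k))) *
        sin (real (2 * i' + 1) * (pi * real (2 * j + 1) / (4 * real k))) =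
        (cos (real (2 * j + 1) * (pi * of_int (int i - int i') / (2 * real k))) -
         cos (real (2 * j + 1) * (pi * of_int (int i + int i' + 1) / (2 * real k)))) / 2" for j
  proof -
    have "real (2 * i + 1) * (pi * real (2 * j + 1) / (4 * real k)) -
          real (2 * i' + 1) * (pi * real (2 * j + 1) / (4 * real k)) =
          real (2 * j + 1) * (pi * of_int (int i - int i') / (2 * real k))"
      and "real (2 * i + 1) * (pi * real (2 * j + 1) / (4 * real k)) +
          real (2 * i' + 1) * (pi * real (2 * j + 1) / (4 * real k)) =
          real (2 * j + 1) * (pi * of_int (int i + int i' + 1) / (2 * real k))"
      using k by (simp_all add: field_simps)
    thus ?thesis by (simp only: sin_times_sin)
  qed
  hence "(\<Sum>j<k. sin (real (2 * i + 1) * (pi * real (2 * j + 1) / (4 * real k))) *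
                  sin (real (2 * i' + 1) * (pi * real (2 * j + 1) / (4 * real k)))) =
         (C (int i - int i') - C (int i + int i' + 1)) / 2"
    unfolding C_def sum_subtractf[symmetric] sum_divide_distrib by (simp only:)
  also have "C (int i + int i' + 1) = 0"
    unfolding C_def using assms by (intro sum_cos_odd_multiples_eq_0) auto
  also have "C (int i - int i') = (if i = i' then real k else 0)"
  proof (cases "i = i'")
    case False
    thus ?thesis
      using assms sum_cos_odd_multiples_eq_0[of "int i - int i'" k] by (simp add: C_def)
  qed (simp add: C_def)
  also have "((if i = i' then real k else 0) - 0) / 2 = (if i = i' then real k / 2 else 0)"
    by simp
  finally show ?thesis .
qed

text \<open>\<open>w_emb\<close> is a Dirichlet kernel, and multiplying it by the sine makes it
  telescope. The product form avoids division by the sine.\<close>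

lemma w_emb_mult_sin:
  "w_emb m a i * sin (pi * real a / 2 ^ m) = sin (real (2 * i + 1) * (pi * real a / 2 ^ m))"
proof (induction i)
  case 0
  show ?case by (simp add: w_emb_def)
next
  case (Suc i)
  define A where "A = pi * real a / 2 ^ m"
  have "theta_emb m a (Suc i) * sin A = 2 * cos (real (2 * i + 2) * A) * sin A"
    by (simp add: theta_emb_def A_def mult_ac ring_distribs)
  also have "\<dots> = sin (real (2 * i + 2) * A + A) - sin (real (2 * i + 2) * A - A)"
    by (simp add: sin_add sin_diff)
  also have "\<dots> = sin (real (2 * Suc i + 1) * A) - sin (real (2 * i + 1) * A)"
    by (simp add: algebra_simps)
  finally show ?case
    using Suc by (simp add: w_emb_def distrib_right flip: A_def)
qed

lemma beta_emb_eq: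
  "beta_emb p m a = 2 / (2 ^ (m - 2) * real p ^ 2) * sin (pi * real a / 2 ^ m) ^ 2"
proof -
  have theta: "theta_emb m a 1 = 2 - 4 * sin (pi * real a / 2 ^ m) ^ 2"
    using cos_double_sin[of "pi * real a / 2 ^ m"] by (simp add: theta_emb_def mult_ac)
  show ?thesis unfolding beta_emb_def theta by (simp add: field_simps)
qed

text \<open>The squared sine in beta supplies one sine to each of the two \<open>w_emb\<close>
  factors, turning the sum into the sine orthogonality relation.\<close>

lemma sum_beta_emb_w_emb:
  assumes "m \<ge> 2" "i < 2 ^ (m - 2)" "i' < 2 ^ (m - 2)"
  shows "(\<Sum>j<2 ^ (m - 2). beta_emb p m (2 * j + 1) * (w_emb m (2 * j + 1) i * w_emb m (2 * j + 1) i')) =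
         (if i = i' then 1 / real p ^ 2 else 0)"
proof -
  define k :: nat where "k = 2 ^ (m - 2)"
  \<comment> \<open>This matches the angle pi (2j+1) / 2^m with that of the sine transform of size
    \<open>k\<close>.\<close>
  have pow: "2 ^ m = 4 * real k"
    using assms(1) le_add_diff_inverse[of 2 m] power_add[of "2 :: real" 2 "m - 2"]
    by (simp add: k_def)
  define S where "S j i = sin (real (2 * i + 1) * (pi * real (2 * j + 1) / (4 * real k)))" for i j
  have "beta_emb p m (2 * j + 1) * (w_emb m (2 * j + 1) i * w_emb m (2 * j + 1) i') =
      2 / (real k * real p ^ 2) * (S j i * S j i')" for j
    unfolding S_def pow[symmetric] w_emb_mult_sin[symmetric] beta_emb_eq
    by (simp add: k_def power2_eq_square mult_ac)
  hence "(\<Sum>j<k. beta_emb p m (2 * j + 1) * (w_emb m (2 * j + 1) i * w_emb m (2 * j + 1) i')) =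
      2 / (real k * real p ^ 2) * (\<Sum>j<k. S j i * S j i')"
    by (simp only: sum_distrib_left)
  also have "(\<Sum>j<k. S j i * S j i') = (if i = i' then real k / 2 else 0)"
    unfolding S_def using assms by (intro sum_sin_odd_multiples_mult) (auto simp: k_def)
  finally show ?thesis by (simp add: k_def)
qed

section \<open>The embedding phi_beta and its orthonormal frame\<close>

lemma phi_vec_add:
  "phi_vec p l m (\<lambda>s a. f s a + g s a) = (\<lambda>c. phi_vec p l m f c + phi_vec p l m g c)"
  by (auto simp: phi_vec_def fun_eq_iff distrib_left)

lemma phi_vec_diff:
  "phi_vec p l m (\<lambda>s a. f s a - g s a) = (\<lambda>c. phi_vec p l m f c - phi_vec p l m g c)"
  by (auto simp: phi_vec_def fun_eq_iff right_diff_distrib)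

text \<open>An embedding of KL is a pair of embeddings of K and L, so the inner product of two pure
  products splits into a K-factor and an L-factor.\<close>

lemma sum_phi_vec_mult:
  fixes m :: nat
  defines "k \<equiv> 2 ^ (m - 2)"
  shows "(\<Sum>c<k * l. phi_vec p l m (\<lambda>s a. f a * g s) c * phi_vec p l m (\<lambda>s a. f' a * g' s) c) =
    (\<Sum>s<l. g s * g' s) * (\<Sum>j<k. beta_emb p m (2 * j + 1) * (f (2 * j + 1) * f' (2 * j + 1)))"
proof -
  have phi: "phi_vec p l m (\<lambda>s a. f a * g s) (s * k + j) =
      sqrt (beta_emb p m (2 * j + 1)) * (f (2 * j + 1) * g s)"
    if "s < l" "j < k" for s j f g
  proof -
    have "s * k + j < k * l"
    proof -
      have "s * k + j < (s + 1) * k" using that by simp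
      also have "\<dots> \<le> l * k" using that by (intro mult_right_mono) auto
      finally show ?thesis by (simp add: mult.commute)
    qed
    moreover have "(s * k + j) div k = s" "(s * k + j) mod k = j" using that by auto
    ultimately show ?thesis unfolding phi_vec_def k_def by simp
  qed
  \<comment> \<open>The closed form shows that beta is nonnegative, so the square roots multiply
    back.\<close>
  have beta: "sqrt (beta_emb p m a) * sqrt (beta_emb p m a) = beta_emb p m a" for a
    by (simp add: beta_emb_eq)
  have "(\<Sum>c<k * l. phi_vec p l m (\<lambda>s a. f a * g s) c * phi_vec p l m (\<lambda>s a. f' a * g' s) c) =
      (\<Sum>s<l. \<Sum>j<k. (sqrt (beta_emb p m (2 * j + 1)) * (f (2 * j + 1) * g s)) *
        (sqrt (beta_emb p m (2 * j + 1)) * (f' (2 * j + 1) * g' s)))"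
    unfolding mult.commute[of k l] sum_mult_nat by (intro sum.cong refl) (simp only: phi lessThan_iff)
  also have "\<dots> = (\<Sum>s<l. \<Sum>j<k. (g s * g' s) *
      (beta_emb p m (2 * j + 1) * (f (2 * j + 1) * f' (2 * j + 1))))"
  proof (intro sum.cong refl)
    fix s j
    show "(sqrt (beta_emb p m (2 * j + 1)) * (f (2 * j + 1) * g s)) *
        (sqrt (beta_emb p m (2 * j + 1)) * (f' (2 * j + 1) * g' s)) =
        (g s * g' s) * (beta_emb p m (2 * j + 1) * (f (2 * j + 1) * f' (2 * j + 1)))"
      by (subst (3) beta[symmetric]) (simp only: mult_ac)
  qed
  also have "\<dots> = (\<Sum>s<l. g s * g' s) *
      (\<Sum>j<k. beta_emb p m (2 * j + 1) * (f (2 * j + 1) * f' (2 * j + 1)))"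
    by (simp add: sum_product)
  finally show ?thesis .
qed

theorem theorem9:
  fixes l p r m :: nat and lam :: int
  assumes "odd l" and "l > 1"
    and "prime p" and "[p = 1] (mod l)"
    and "residue_primroot p r"
    and "[lam * (int r - 1) = 1] (mod int p)"
    and "m \<ge> 3"
  shows "\<exists>Q. orthogonal_nat_mat (2 ^ (m - 2) * l) Q \<and>
           lattice_M p l r lam m =
             {row_times (2 ^ (m - 2) * l) y Q | y. y \<in> D_lattice (2 ^ (m - 2) * l)}"
proof -
  interpret primroot_setup l p r lam
    using assms by unfold_locales
  define k :: nat where "k = 2 ^ (m - 2)"
  define n where "n = k * l"
  define x where "x = sig_x p l r lam"
  define E where "E t i = phi_vec p l m (\<lambda>s a. w_emb m a i * x (s + t))" for t i
  \<comment> \<open>Numbering q = i * l + t, with the power of sigma running fastest, turns the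
    generators into combinations of consecutive rows.\<close>
  define Q where "Q q = E (q mod l) (q div l)" for q
  have "k > 0" by (simp add: k_def)
  hence n: "n \<ge> 2"
    using l_gt_1 mult_le_mono[of 1 k 2 l] by (simp add: n_def)

  have E_mult: "(\<Sum>c<n. E t i c * E t' i' c) = (if t = t' \<and> i = i' then 1 else 0)"
    if "t < l" "t' < l" "i < k" "i' < k" for t t' i i'
  proof -
    have "(\<Sum>c<n. E t i c * E t' i' c) =
        (if t = t' then real p ^ 2 else 0) * (if i = i' then 1 / real p ^ 2 else 0)"
      unfolding E_def n_def k_def
      by (subst sum_phi_vec_mult, subst sum_beta_emb_w_emb)
         (use that \<open>m \<ge> 3\<close> in \<open>auto simp: k_def x_def sum_sig_x_mult\<close>)
    thus ?thesis using p_pos by simp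
  qed
  have orth: "orthogonal_nat_mat n Q"
    unfolding orthogonal_nat_mat_def
  proof (intro allI impI)
    fix q q' assume q: "q < n" "q' < n"
    have "q div l < k" "q' div l < k" "q mod l < l" "q' mod l < l"
      using q l_gt_1 by (simp_all add: n_def less_mult_imp_div_less)
    moreover have "q mod l = q' mod l \<and> q div l = q' div l \<longleftrightarrow> q = q'"
      by (metis div_mult_mod_eq)
    ultimately show "(\<Sum>c<n. Q q c * Q q' c) = (if q = q' then 1 else 0)"
      by (simp add: Q_def E_mult)
  qed

  have Q_E: "Q (i * l + t) = E t i" if "t < l" for t i
    using that by (simp add: Q_def)
  have phi_0: "phi_vec p l m (\<lambda>s a. w_emb m a 0 * (x s + x (s + 1))) = (\<lambda>c. Q 0 c + Q 1 c)"
    using Q_E[of 0 0] Q_E[of 1 0] l_gt_1 by (simp add: E_def distrib_left phi_vec_add)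
  \<comment> \<open>The row after (i, l - 1) is (i + 1, 0), so these generators bridge consecutive
    blocks of length \<open>l\<close>.\<close>
  have phi_last: "phi_vec p l m (\<lambda>s a. w_emb m a i * x (s + (l - 1)) - w_emb m a (i + 1) * x s) =
      (\<lambda>c. Q (i * l + (l - 1)) c - Q (i * l + (l - 1) + 1) c)" for i
    using Q_E[of "l - 1" i] Q_E[of 0 "i + 1"] l_gt_1
    by (simp add: E_def phi_vec_diff add.commute)
  have phi_inner: "phi_vec p l m (\<lambda>s a. w_emb m a j * (x (s + i) - x (s + i + 1))) =
      (\<lambda>c. Q (j * l + i) c - Q (j * l + i + 1) c)" if "i + 2 \<le> l" for i j
    using Q_E[of i j] Q_E[of "i + 1" j] that
    by (simp add: E_def right_diff_distrib phi_vec_diff)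
  have gens: "phi_vec p l m ` gens_M p l r lam m =
      {\<lambda>c. Q 0 c + Q 1 c} \<union> {\<lambda>c. Q q c - Q (q + 1) c | q. q + 1 < n}"
  proof -
    let ?d = "\<lambda>q c. Q q c - Q (q + 1) c"
    have image: "phi_vec p l m ` gens_M p l r lam m = {\<lambda>c. Q 0 c + Q 1 c}
       \<union> ({?d (i * l + (l - 1)) | i. i + 2 \<le> k} \<union> {?d (j * l + i) | i j. j < k \<and> i + 2 \<le> l})"
    proof -
      have "phi_vec p l m ` gens_M p l r lam m =
        {phi_vec p l m (\<lambda>s a. w_emb m a 0 * (x s + x (s + 1)))}
        \<union> ({phi_vec p l m (\<lambda>s a. w_emb m a i * x (s + (l - 1)) - w_emb m a (i + 1) * x s) | i.
             i + 2 \<le> k}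
        \<union> {phi_vec p l m (\<lambda>s a. w_emb m a j * (x (s + i) - x (s + i + 1))) | i j.
             j < k \<and> i + 2 \<le> l})"
        unfolding gens_M_def x_def[symmetric] k_def[symmetric] by blast
      also have "{phi_vec p l m (\<lambda>s a. w_emb m a j * (x (s + i) - x (s + i + 1))) | i j.
             j < k \<and> i + 2 \<le> l} = {?d (j * l + i) | i j. j < k \<and> i + 2 \<le> l}"
        using phi_inner by (intro Collect_cong ex_cong1) auto
      finally show ?thesis unfolding phi_0 phi_last .
    qed
    \<comment> \<open>A step from q to q + 1 either crosses a block boundary, when q mod l = l - 1,
      or stays inside a block.\<close>
    have "{q. q + 1 < n} =
        {i * l + (l - 1) | i. i + 2 \<le> k} \<union> {j * l + i | i j. j < k \<and> i + 2 \<le> l}"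
      (is "_ = ?L \<union> ?I")
    proof (intro equalityI subsetI)
      fix q assume q: "q \<in> {q. q + 1 < n}"
      define i where "i = q div l"
      have i: "q = i * l + q mod l" "i < k"
        using q by (simp_all add: i_def n_def less_mult_imp_div_less)
      have "q mod l < l" using l_gt_1 by simp
      show "q \<in> ?L \<union> ?I"
      proof (cases "q mod l = l - 1")
        case True
        \<comment> \<open>Otherwise q would be n - 1, the last row, which has no successor.\<close>
        have "i + 1 \<noteq> k"
        proof
          assume "i + 1 = k"
          hence "n = i * l + l" by (auto simp: n_def)
          thus False using q i(1) True l_gt_1 by auto
        qed
        with i True show ?thesis by auto
      next
        case False
        hence "q mod l + 2 \<le> l" using \<open>q mod l < l\<close> by linarith
        with i show ?thesis by blast
      qed
    next
      fix q assume "q \<in> ?L \<union> ?I"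
      then obtain i t where q: "q = i * l + t" and it: "t < l" "i < k" "t + 2 \<le> l \<or> i + 2 \<le> k"
        using l_gt_1 by fastforce
      show "q \<in> {q. q + 1 < n}"
      proof (cases "t + 2 \<le> l")
        case True
        hence "q + 1 < (i + 1) * l" using q by simp
        also have "\<dots> \<le> n" unfolding n_def using it by (intro mult_right_mono) auto
        finally show ?thesis by simp
      next
        case False
        hence "q + 1 < (i + 2) * l" using q it l_gt_1 by simp
        also have "\<dots> \<le> n" unfolding n_def using it False by (intro mult_right_mono) auto
        finally show ?thesis by simp
      qed
    qed
    hence "?d ` {q. q + 1 < n} = ?d ` {i * l + (l - 1) | i. i + 2 \<le> k}
        \<union> ?d ` {j * l + i | i j. j < k \<and> i + 2 \<le> l}"
      by (simp only: image_Un)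
    hence "{?d q | q. q + 1 < n} = {?d (i * l + (l - 1)) | i. i + 2 \<le> k}
        \<union> {?d (j * l + i) | i j. j < k \<and> i + 2 \<le> l}"
      unfolding image_def by blast
    with image show ?thesis by simp
  qed
  \<comment> \<open>The cutoff at \<open>n\<close> in \<open>row_times\<close> is harmless because
    \<open>phi_vec\<close> vanishes there.\<close>
  have "row_times n y Q = (\<lambda>c. \<Sum>i<n. of_int (y i) * Q i c)" for y
    by (auto simp: row_times_def Q_def E_def phi_vec_def n_def k_def fun_eq_iff)
  hence "lattice_M p l r lam m = {row_times n y Q | y. y \<in> D_lattice n}"
    unfolding lattice_M_def gens using int_span_D_basis[OF n, of Q] by simp
  with orth show ?thesis unfolding n_def k_def by blast
qed

end
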